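(* Let $k\ge 0$ and let $\delta t_k>0$ be an arbitrary time step. Let $\mathbf n^k=[n_1^k,\dots,n_M^k]^T$, $\mathbf u^k$, $H^k\in\mathbb R$ be given. For $0\le i\le M$ write $\mathbf n^{k+\frac iM}=[n_1^{k+1},\dots,n_i^{k+1},n_{i+1}^k,\dots,n_M^k]^T$ (so $\mathbf n^{k+\frac0M}=\mathbf n^k$ and $\mathbf n^{k+\frac MM}=\mathbf n^{k+1}$). Suppose that $n_1^{k+1},\dots,n_M^{k+1}$, the scalars $H^{k+\frac1M},\dots,H^{k+\frac MM}=H^{k+1}$, and $\mathbf u^{k+1}$ satisfy the following component-wise time-discrete scheme in $\Omega$ (with the setting, boundary conventions and standing assumptions of the context). (i) Discrete chemical potentials and scalar auxiliary variable: for $1\le i\le M$, $$\mu_i^{k+\frac iM}=\frac{H^{k+\frac iM}+H^{k+\frac{i-1}M}}{2\sqrt{F_b(\mathbf n^k)+\sum_{j=1}^M C_{T,j}N_j^t}}\,\mu_i^b\left(\mathbf n^{k+\frac{i-1}M}\right)-\sum_{j=1}^i\nabla\cdot\left(c_{ij}\nabla n_j^{k+1}\right)-\sum_{j=i+1}^M\nabla\cdot\left(c_{ij}\nabla n_j^k\right),$$ $$\frac{H^{k+\frac iM}-H^{k+\frac{i-1}M}}{\delta t_k}=\int_\Omega\frac{\mu_i^b\left(\mathbf n^{k+\frac{i-1}M}\right)}{2\sqrt{F_b(\mathbf n^k)+\sum_{j=1}^M C_{T,j}N_j^t}}\;\frac{n_i^{k+1}-n_i^k}{\delta t_k}\,d\mathbf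 x .$$ (ii) Intermediate velocities: $\mathbf u_\star^{k+0}=\mathbf u^k$ and $$\mathbf u_\star^{k+\frac iM}=\mathbf u_\star^{k+\frac{i-1}M}-\frac{\delta t_k}{\rho^k}n_i^k\nabla\mu_i^{k+\frac iM}\quad(1\le i\le M),\qquad \mathbf u_{\star\star}^k=\sum_{i=1}^M\frac{\rho_i^k}{\rho^k}\mathbf u_\star^{k+\frac iM}.$$ (iii) Mass balance: for $1\le i\le M$, $$\frac{n_i^{k+1}-n_i^k}{\delta t_k}+\nabla\cdot\left(n_i^k\mathbf u_\star^{k+\frac iM}\right)+\nabla\cdot\mathbf J_i^{k+\frac iM}=0,\qquad \mathbf J_i^{k+\frac iM}=-\mathcal M_i^k\nabla\mu_i^{k+\frac iM}.$$ (iv) Momentum balance, with $\mathbf u_\star^{k+1}=\mathbf u_\star^{k+\frac MM}$: $$\rho^k\frac{\mathbf u^{k+1}-\mathbf u_\star^{k+1}}{\delta t_k}+\rho^k\mathbf u_{\star\star}^k\cdot\nabla\mathbf u^{k+1}+\sum_{i=1}^M M_{w,i}\mathbf J_i^{k+\frac iM}\cdot\nabla\mathbf u^{k+1}=\nabla\left(\lambda^k\nabla\cdot\mathbf u^{k+1}\right)+\nabla\cdot\left(\eta^k\left(\nabla\mathbf u^{k+1}+(\nabla\mathbf u^{k+1})^T\right)\right).$$ For $m\in\{k,k+1\}$ define the discrete kinetic energy and the modified Helmholtz free energy by $$E^m=\frac12\int_\Omega\rho^m|\mathbf u^m|^2\,d\mathbf x,\qquad \mathcal F^m=|H^m|^2+\frac12\int_\Omega\sum_{i,j=1}^M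 c_{ij}\nabla n_i^m\cdot\nabla n_j^m\,d\mathbf x-\sum_{i=1}^M C_{T,i}N_i^t .$$ Then $$E^{k+1}+\mathcal F^{k+1}\le E^k+\mathcal F^k .$$
   Context: **Domain and boundary convention.** $\Omega\subset\mathbb R^d$ ($1\le d\le 3$) is an open, bounded, connected domain with sufficiently smooth boundary. All fields are sufficiently smooth, and the boundary conditions (e.g. homogeneous Neumann-type/no-flux conditions or periodic conditions) are such that all boundary terms vanish whenever integration by parts is performed in the terms of the scheme; that is, the divergence terms $\nabla\cdot(c_{ij}\nabla n_j)$, the divergences of the convective fluxes and of the diffusion fluxes $\mathbf J_i$, and the viscous terms may be integrated by parts over $\Omega$ against scalar (including constant) or velocity fields of the scheme without boundary contributions. **Unknowns.** $M\ge1$ is the number of chemical components. $n_i^m:\Omega\to\mathbb R$ is the molar density of component $i$ at time step $m$; $\mathbf u^m:\Omega\to\mathbb R^d$ is the velocity; $H^m\in\mathbb R$ is a scalar auxiliary variable, approximating $H(t)=\sqrt{F_b+\sum_i C_{T,i}N_i^t}$ at time $t_m$. $M_{w,i}>0$ is the molar weight of component $i$, $\rho_i^m=M_{w,i}n_i^m$ is the mass density of component $i$, and $\rho^m=\sum_{i=1}^M\rho_i^m$ is the overall mass density; $\rho^k>0$. For a vector field $\mathbf v$, $\mathbf v\cdot\nabla\mathbf u$ means $(\mathbf v\cdot\nabla)\mathbf u$. **Free energy.** $F_b(\mathbf n)=\int_\Omega f_b(\mathbf n)\,d\mathbf x$ and $\mu_i^b(\mathbf n)=\partial f_b(\mathbf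 n)/\partial n_i$, where $f_b$ is the Peng–Robinson bulk Helmholtz free energy density at fixed temperature $T>0$: with $n=\sum_i n_i$, $$f_b(\mathbf n)=RT\sum_{i=1}^M n_i(\ln n_i-1)-nRT\ln(1-bn)+\frac{a\,n}{2\sqrt2\,b}\ln\left(\frac{1+(1-\sqrt2)bn}{1+(1+\sqrt2)bn}\right),$$ $$a=\sum_{i,j=1}^M y_iy_j(a_ia_j)^{1/2}(1-k_{ij}),\quad b=\sum_{i=1}^M y_ib_i,\quad y_i=n_i/n,$$ where $R>0$ is the universal gas constant, $k_{ij}$ are constant binary interaction coefficients, and $a_i=0.45724\frac{R^2T_{c_i}^2}{P_{c_i}}[1+m_i(1-\sqrt{T/T_{c_i}})]^2$, $b_i=0.07780\frac{RT_{c_i}}{P_{c_i}}$ are constants determined by the critical temperature $T_{c_i}$ and critical pressure $P_{c_i}$ of component $i$ and by a constant $m_i$ given by the acentric factor $\omega_i$ ($m_i=0.37464+1.54226\omega_i-0.26992\omega_i^2$ if $\omega_i\le0.49$; $m_i=0.379642+1.485030\omega_i-0.164423\omega_i^2+0.016666\omega_i^3$ if $\omega_i>0.49$). The density vectors $\mathbf n^{k+\frac{i}{M}}$, $0\le i\le M-1$, take values in the domain of $f_b$. **Coefficients.** $(c_{ij})_{i,j=1}^M$ is a constant, symmetric, positive definite or positive semidefinite matrix (influence parameters, depending only on temperature). $C_{T,i}\ge0$ are constants independent of the molar densities. $N_i^t=\int_\Omega n_i^k\,d\mathbf x$ is the total number of moles of component $i$, which does not depend on the time step $k$ (mass is conserved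 by the scheme under the boundary convention). The constants $C_{T,i}$ are chosen so that $F_b(\mathbf n^k)+\sum_jC_{T,j}N_j^t>0$, so that the square root in the denominators is nonzero. The mobility tensor is diagonal with diagonal entries $\mathcal M_i^k\ge0$ evaluated from $\mathbf n^k$ (so in general depending on $\mathbf x$; for instance $\mathcal M_i^k=D_in_i^k/(RT)$ with $D_i>0$). $\eta^k>0$ (shear viscosity) and $\lambda^k=\xi^k-\frac23\eta^k>0$ (with $\xi^k$ the volumetric viscosity) are the viscosity coefficients at step $k$. *)

theory Defs
  imports "HOL-Analysis.Analysis"
begin

section \<open>Differential operators on fields over real coordinate space\<close>

definition pd :: "'d::finite \<Rightarrow> (real^'d \<Rightarrow> 'b::real_normed_vector) \<Rightarrow> real^'d \<Rightarrow> 'b" where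
  "pd a f x = frechet_derivative f (at x) (axis a 1)"

definition grad :: "(real^'d::finite \<Rightarrow> real) \<Rightarrow> real^'d \<Rightarrow> real^'d" where
  "grad f x = (\<chi> a. pd a f x)"

definition divg :: "(real^'d::finite \<Rightarrow> real^'d) \<Rightarrow> real^'d \<Rightarrow> real" where
  "divg F x = (\<Sum>a\<in>UNIV. pd a F x $ a)"

definition vgrad :: "(real^'d::finite \<Rightarrow> real^'d) \<Rightarrow> real^'d \<Rightarrow> real^'d^'d" where
  "vgrad u x = (\<chi> a b. pd b u x $ a)"

definition tdivg :: "(real^'d::finite \<Rightarrow> real^'d^'d) \<Rightarrow> real^'d \<Rightarrow> real^'d" where
  "tdivg S x = (\<chi> a. \<Sum>b\<in>UNIV. pd b S x $ a $ b)"

text \<open>\<open>convect v u\<close> is $(v\cdot\nabla)u$.\<close>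

definition convect :: "real^'d::finite \<Rightarrow> (real^'d \<Rightarrow> real^'d) \<Rightarrow> real^'d \<Rightarrow> real^'d" where
  "convect v u x = (\<Sum>b\<in>UNIV. (v $ b) *\<^sub>R pd b u x)"

definition sym_grad :: "(real^'d::finite \<Rightarrow> real^'d) \<Rightarrow> real^'d \<Rightarrow> real^'d^'d" where
  "sym_grad u x = vgrad u x + transpose (vgrad u x)"


section \<open>Regularity and boundary convention\<close>

text \<open>The space $C^r(\overline\Omega)$: all partial derivatives of order at most $r$ exist in the
  open set \<open>\<Omega>\<close> and extend continuously to its closure. Only the values on \<open>\<Omega>\<close> matter.\<close>

primrec C_closure :: "nat \<Rightarrow> (real^'d::finite) set \<Rightarrow> (real^'d \<Rightarrow> 'b::real_normed_vector) \<Rightarrow> bool" where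
  "C_closure 0 \<Omega> f \<longleftrightarrow> (\<exists>g. continuous_on (closure \<Omega>) g \<and> (\<forall>x\<in>\<Omega>. g x = f x))"
| "C_closure (Suc r) \<Omega> f \<longleftrightarrow>
     (\<exists>g. continuous_on (closure \<Omega>) g \<and> (\<forall>x\<in>\<Omega>. g x = f x)) \<and>
     (\<forall>x\<in>\<Omega>. f differentiable (at x)) \<and> (\<forall>a. C_closure r \<Omega> (pd a f))"

text \<open>Local description of the boundary by a $C^1$ defining function with nonvanishing gradient.\<close>

definition C1_boundary :: "(real^'d::finite) set \<Rightarrow> bool" where
  "C1_boundary \<Omega> \<longleftrightarrow> (\<forall>p\<in>frontier \<Omega>. \<exists>U \<phi>. open U \<and> p \<in> U \<and>
     (\<forall>x\<in>U. \<phi> differentiable (at x)) \<and> continuous_on U (grad \<phi>) \<and> grad \<phi> p \<noteq> 0 \<and>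
     \<Omega> \<inter> U = {x\<in>U. \<phi> x < 0} \<and> frontier \<Omega> \<inter> U = {x\<in>U. \<phi> x = 0})"

text \<open>The divergence of the flux \<open>F\<close> can be integrated by parts over \<open>\<Omega>\<close> against the scalar
  field \<open>\<phi>\<close> without a boundary contribution.\<close>

definition ibp :: "(real^'d::finite) set \<Rightarrow> (real^'d \<Rightarrow> real) \<Rightarrow> (real^'d \<Rightarrow> real^'d) \<Rightarrow> bool" where
  "ibp \<Omega> \<phi> F \<longleftrightarrow>
     (LINT x:\<Omega>|lborel. \<phi> x * divg F x) = - (LINT x:\<Omega>|lborel. grad \<phi> x \<bullet> F x)"

definition viscous :: "(real^'d::finite \<Rightarrow> real) \<Rightarrow> (real^'d \<Rightarrow> real) \<Rightarrow>
    (real^'d \<Rightarrow> real^'d) \<Rightarrow> real^'d \<Rightarrow> real^'d" where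
  "viscous lam eta u x =
     grad (\<lambda>y. lam y * divg u y) x + tdivg (\<lambda>y. eta y *\<^sub>R sym_grad u y) x"

text \<open>The viscous force of the velocity \<open>u\<close> can be integrated by parts against the velocity
  field \<open>w\<close> without a boundary contribution. The inner product of matrices is the Frobenius
  product.\<close>

definition ibp_viscous :: "(real^'d::finite) set \<Rightarrow> (real^'d \<Rightarrow> real) \<Rightarrow> (real^'d \<Rightarrow> real) \<Rightarrow>
    (real^'d \<Rightarrow> real^'d) \<Rightarrow> (real^'d \<Rightarrow> real^'d) \<Rightarrow> bool" where
  "ibp_viscous \<Omega> lam eta u w \<longleftrightarrow>
     (LINT x:\<Omega>|lborel. w x \<bullet> viscous lam eta u x) =
     - (LINT x:\<Omega>|lborel. lam x * divg u x * divg w x + eta x * (sym_grad u x \<bullet> vgrad w x))"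

text \<open>The scalar fields against which the fluxes of the scheme are tested. The field
  $|u|^2$ occurs because a convective or diffusive flux $v$ transports momentum: testing
  $v\cdot\nabla u$ with the velocity $u$ leaves the boundary term
  $\frac12\int_{\partial\Omega}|u|^2\,v\cdot\nu$.\<close>

definition scheme_scalars :: "nat \<Rightarrow> (nat \<Rightarrow> real^'d::finite \<Rightarrow> real) \<Rightarrow> (nat \<Rightarrow> real^'d \<Rightarrow> real) \<Rightarrow>
    (nat \<Rightarrow> real^'d \<Rightarrow> real) \<Rightarrow> (real^'d \<Rightarrow> real^'d) \<Rightarrow> (real^'d \<Rightarrow> real) set" where
  "scheme_scalars M n_old n_new mu u_new =
     range (\<lambda>r x. r) \<union> n_old ` {1..M} \<union> n_new ` {1..M} \<union> mu ` {1..M} \<union> {\<lambda>x. u_new x \<bullet> u_new x}"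


section \<open>Peng--Robinson bulk free energy\<close>

text \<open>Components are indexed by \<open>{1..M}\<close>; a density vector is a function \<open>nat \<Rightarrow> real\<close> of which only
  these indices matter.\<close>

record pr_fluid =
  pr_R :: real
  pr_T :: real
  pr_k :: "nat \<Rightarrow> nat \<Rightarrow> real"
  pr_Tc :: "nat \<Rightarrow> real"
  pr_Pc :: "nat \<Rightarrow> real"
  pr_omega :: "nat \<Rightarrow> real"

definition pr_m :: "pr_fluid \<Rightarrow> nat \<Rightarrow> real" where
  "pr_m P i = (let w = pr_omega P i in
     if w \<le> 0.49 then 0.37464 + 1.54226 * w - 0.26992 * w^2
     else 0.379642 + 1.485030 * w - 0.164423 * w^2 + 0.016666 * w^3)"

definition pr_ai :: "pr_fluid \<Rightarrow> nat \<Rightarrow> real" where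
  "pr_ai P i = 0.45724 * ((pr_R P)^2 * (pr_Tc P i)^2 / pr_Pc P i) *
     (1 + pr_m P i * (1 - sqrt (pr_T P / pr_Tc P i)))^2"

definition pr_bi :: "pr_fluid \<Rightarrow> nat \<Rightarrow> real" where
  "pr_bi P i = 0.07780 * (pr_R P * pr_Tc P i / pr_Pc P i)"

definition total :: "nat \<Rightarrow> (nat \<Rightarrow> real) \<Rightarrow> real" where
  "total M v = (\<Sum>i=1..M. v i)"

definition mole_frac :: "nat \<Rightarrow> (nat \<Rightarrow> real) \<Rightarrow> nat \<Rightarrow> real" where
  "mole_frac M v i = v i / total M v"

definition pr_a :: "pr_fluid \<Rightarrow> nat \<Rightarrow> (nat \<Rightarrow> real) \<Rightarrow> real" where
  "pr_a P M v = (\<Sum>i=1..M. \<Sum>j=1..M.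
     mole_frac M v i * mole_frac M v j * sqrt (pr_ai P i * pr_ai P j) * (1 - pr_k P i j))"

definition pr_b :: "pr_fluid \<Rightarrow> nat \<Rightarrow> (nat \<Rightarrow> real) \<Rightarrow> real" where
  "pr_b P M v = (\<Sum>i=1..M. mole_frac M v i * pr_bi P i)"

definition f_b :: "pr_fluid \<Rightarrow> nat \<Rightarrow> (nat \<Rightarrow> real) \<Rightarrow> real" where
  "f_b P M v = (let n = total M v; a = pr_a P M v; b = pr_b P M v in
     pr_R P * pr_T P * (\<Sum>i=1..M. v i * (ln (v i) - 1))
     - n * pr_R P * pr_T P * ln (1 - b * n)
     + a * n / (2 * sqrt 2 * b) * ln ((1 + (1 - sqrt 2) * b * n) / (1 + (1 + sqrt 2) * b * n)))"

text \<open>The vectors for which all logarithms in \<open>f_b\<close> have positive arguments; for the third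
  logarithm this follows from the bound on \<open>b * n\<close>.\<close>

definition f_b_domain :: "pr_fluid \<Rightarrow> nat \<Rightarrow> (nat \<Rightarrow> real) set" where
  "f_b_domain P M = {v. (\<forall>i\<in>{1..M}. 0 < v i) \<and> pr_b P M v * total M v < 1}"

definition mu_b :: "pr_fluid \<Rightarrow> nat \<Rightarrow> nat \<Rightarrow> (nat \<Rightarrow> real) \<Rightarrow> real" where
  "mu_b P M i v = deriv (\<lambda>s. f_b P M (v(i := s))) (v i)"

definition F_b :: "pr_fluid \<Rightarrow> nat \<Rightarrow> (real^'d::finite) set \<Rightarrow> (nat \<Rightarrow> real^'d \<Rightarrow> real) \<Rightarrow> real" where
  "F_b P M \<Omega> n = (LINT x:\<Omega>|lborel. f_b P M (\<lambda>j. n j x))"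


section \<open>Discrete quantities\<close>

text \<open>\<open>n_frac n k i\<close> is the density vector $n^{k+i/M}$, whose first \<open>i\<close> components are new.\<close>

definition n_frac :: "(nat \<Rightarrow> nat \<Rightarrow> 'x \<Rightarrow> real) \<Rightarrow> nat \<Rightarrow> nat \<Rightarrow> 'x \<Rightarrow> nat \<Rightarrow> real" where
  "n_frac n k i x j = (if j \<le> i then n (Suc k) j x else n k j x)"

definition moles :: "(real^'d::finite) set \<Rightarrow> (real^'d \<Rightarrow> real) \<Rightarrow> real" where
  "moles \<Omega> f = (LINT x:\<Omega>|lborel. f x)"

definition rho :: "nat \<Rightarrow> (nat \<Rightarrow> real) \<Rightarrow> (nat \<Rightarrow> 'x \<Rightarrow> real) \<Rightarrow> 'x \<Rightarrow> real" where
  "rho M Mw n x = (\<Sum>i=1..M. Mw i * n i x)"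

definition kinetic :: "(real^'d::finite) set \<Rightarrow> nat \<Rightarrow> (nat \<Rightarrow> real) \<Rightarrow>
    (nat \<Rightarrow> real^'d \<Rightarrow> real) \<Rightarrow> (real^'d \<Rightarrow> real^'d) \<Rightarrow> real" where
  "kinetic \<Omega> M Mw n u = 1/2 * (LINT x:\<Omega>|lborel. rho M Mw n x * (norm (u x))^2)"

definition helmholtz :: "(real^'d::finite) set \<Rightarrow> nat \<Rightarrow> (nat \<Rightarrow> nat \<Rightarrow> real) \<Rightarrow> (nat \<Rightarrow> real) \<Rightarrow>
    (nat \<Rightarrow> real) \<Rightarrow> (nat \<Rightarrow> real^'d \<Rightarrow> real) \<Rightarrow> real \<Rightarrow> real" where
  "helmholtz \<Omega> M c CT N n H = \<bar>H\<bar>^2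
     + 1/2 * (LINT x:\<Omega>|lborel. \<Sum>i=1..M. \<Sum>j=1..M. c i j * (grad (n i) x \<bullet> grad (n j) x))
     - (\<Sum>i=1..M. CT i * N i)"

end

theory Submission
  imports Defs
begin

text \<open>Write \<open>\<delta>\<^sub>i\<close> for the increment of the \<open>i\<close>-th density. The increment of \<open>H\<^sup>2\<close> telescopes over
  the components, and the update of \<open>H\<close> turns each summand into \<open>\<integral> \<mu>\<^sub>i \<delta>\<^sub>i\<close> minus the cross terms
  of the gradient energy. Replacing the components one after the other changes the gradient
  energy by at most these cross terms, the defect being the sum of
  \<open>\<onehalf> c\<^sub>i\<^sub>i \<bar>\<nabla>\<delta>\<^sub>i\<bar>\<^sup>2\<close>. So the free energy grows by at most the sum of the \<open>\<integral> \<mu>\<^sub>i \<delta>\<^sub>i\<close>. By the mass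
  balance and the definition of the intermediate velocities, \<open>\<integral> \<mu>\<^sub>i \<delta>\<^sub>i\<close> is at most the
  kinetic energy lost between two successive intermediate velocities, all taken with the old
  density. Finally, testing the mass balances with \<open>\<bar>u\<bar>\<^sup>2\<close> and the momentum balance with the new
  velocity \<open>u\<close> bounds the new kinetic energy by that of the last intermediate velocity.\<close>

text \<open>A class of fields that is stable under products and integrable over bounded open sets.\<close>

definition bcont :: "'a::topological_space set \<Rightarrow> ('a \<Rightarrow> 'b::real_normed_vector) \<Rightarrow> bool" where
  "bcont S f \<longleftrightarrow> continuous_on S f \<and> bounded (f ` S)"

named_theorems bcont_intros

lemma bcont_cong: "(\<And>x. x \<in> S \<Longrightarrow> f x = g x) \<Longrightarrow> bcont S f \<longleftrightarrow> bcont S g"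
  by (simp add: bcont_def cong: continuous_on_cong image_cong)

lemma bcont_const [bcont_intros]: "bcont S (\<lambda>x. r)"
  by (auto simp: bcont_def image_constant_conv)

lemma bcont_linear:
  assumes "bounded_linear L" and "bcont S f"
  shows "bcont S (\<lambda>x. L (f x))"
proof -
  interpret bounded_linear L by fact
  have "bounded (L ` (f ` S))"
    using assms by (intro bounded_linear_image) (auto simp: bcont_def)
  then show ?thesis
    using assms by (auto simp: bcont_def image_image intro: continuous_on)
qed

text \<open>A bounded bilinear map sends bounded fields to bounded ones; products, scalings and
  inner products are all instances.\<close>

lemma bcont_bilinear:
  assumes "bounded_bilinear B" and "bcont S f" and "bcont S g"
  shows "bcont S (\<lambda>x. B (f x) (g x))"
proof -
  interpret bounded_bilinear B by fact
  obtain K where K: "\<And>a b. norm (B a b) \<le> norm a * norm b * K" "0 \<le> K"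
    using nonneg_bounded by blast
  obtain C D where C: "\<And>x. x \<in> S \<Longrightarrow> norm (f x) \<le> C" and D: "\<And>x. x \<in> S \<Longrightarrow> norm (g x) \<le> D"
    using assms(2,3) by (auto simp: bcont_def bounded_iff)
  have "norm (B (f x) (g x)) \<le> C * D * K" if "x \<in> S" for x
  proof (rule order_trans[OF K(1)])
    have "0 \<le> C" using norm_ge_zero C[OF that] by (rule order_trans)
    then show "norm (f x) * norm (g x) * K \<le> C * D * K"
      using C[OF that] D[OF that] K(2) by (intro mult_right_mono mult_mono) auto
  qed
  then show ?thesis
    using assms(2,3) by (auto simp: bcont_def bounded_iff intro: continuous_on)
qed

lemmas bcont_mult [bcont_intros] = bcont_bilinear[OF bounded_bilinear_mult]
  and bcont_scaleR [bcont_intros] = bcont_bilinear[OF bounded_bilinear_scaleR]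
  and bcont_inner [bcont_intros] = bcont_bilinear[OF bounded_bilinear_inner]
  and bcont_vec_nth [bcont_intros] = bcont_linear[OF bounded_linear_vec_nth]

lemma bcont_divide [bcont_intros]:
  fixes f :: "_ \<Rightarrow> real"
  shows "bcont S f \<Longrightarrow> bcont S (\<lambda>x. f x / s)"
  unfolding divide_inverse by (intro bcont_intros)

lemma bcont_add [bcont_intros]: "bcont S f \<Longrightarrow> bcont S g \<Longrightarrow> bcont S (\<lambda>x. f x + g x)"
  by (auto simp: bcont_def intro!: continuous_intros bounded_plus_comp)

lemma bcont_uminus [bcont_intros]: "bcont S f \<Longrightarrow> bcont S (\<lambda>x. - f x)"
  by (rule bcont_linear) (rule bounded_linear_minus[OF bounded_linear_ident])

lemma bcont_diff [bcont_intros]: "bcont S f \<Longrightarrow> bcont S g \<Longrightarrow> bcont S (\<lambda>x. f x - g x)"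
  by (auto simp: bcont_def intro!: continuous_intros bounded_minus_comp)

lemma bcont_sum [bcont_intros]:
  "(\<And>i. i \<in> I \<Longrightarrow> bcont S (f i)) \<Longrightarrow> bcont S (\<lambda>x. \<Sum>i\<in>I. f i x)"
  by (induction I rule: infinite_finite_induct) (auto intro: bcont_intros)

text \<open>The field is dominated by a constant, and a bounded set has finite measure.\<close>

lemma bcont_set_integrable:
  fixes f :: "'a::euclidean_space \<Rightarrow> 'b::{banach, second_countable_topology}"
  assumes "open S" and "bounded S" and "bcont S f"
  shows "set_integrable lborel S f"
proof -
  obtain B where B: "\<And>x. x \<in> S \<Longrightarrow> norm (f x) \<le> B"
    using assms(3) by (auto simp: bcont_def bounded_iff)
  have fin: "emeasure lborel S < \<infinity>"
    using assms(2) by (rule emeasure_bounded_finite)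
  have S: "S \<in> sets borel" using assms(1) by simp
  have "set_integrable lborel S (\<lambda>x. B)"
    unfolding set_integrable_def using fin S by simp
  moreover have "set_borel_measurable lborel S f"
    using borel_measurable_continuous_on_indicator[of S f] S assms(3)
    by (simp add: set_borel_measurable_def bcont_def)
  ultimately show ?thesis
    by (rule set_integrable_bound) (use B in \<open>fastforce intro!: AE_I2\<close>)
qed

section \<open>Regularity up to the boundary and differential operators\<close>

text \<open>The continuous extension lives on a compact set, since the closure of a bounded set is
  compact, and is therefore bounded.\<close>

lemma C_closure_bcont:
  assumes "bounded \<Omega>" and "C_closure r \<Omega> f"
  shows "bcont \<Omega> f"
proof -
  obtain g where g: "continuous_on (closure \<Omega>) g" "\<forall>x\<in>\<Omega>. g x = f x"
    using assms(2) by (cases r) auto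
  have "bounded (g ` closure \<Omega>)"
    using assms(1) g(1) by (intro compact_imp_bounded compact_continuous_image) auto
  then have "bcont \<Omega> g"
    using g(1) closure_subset by (metis bcont_def bounded_subset continuous_on_subset image_mono)
  then show ?thesis using g(2) bcont_cong by metis
qed

lemma C_closure_SucD:
  assumes "C_closure (Suc r) \<Omega> f"
  shows "\<And>x. x \<in> \<Omega> \<Longrightarrow> f differentiable (at x)" and "\<And>a. C_closure r \<Omega> (pd a f)"
  using assms by auto

lemma pd_eq: "(f has_derivative D) (at x) \<Longrightarrow> pd a f x = D (axis a 1)"
  unfolding pd_def by (metis frechet_derivative_at)

lemma bcont_pd: "bounded \<Omega> \<Longrightarrow> C_closure (Suc r) \<Omega> f \<Longrightarrow> bcont \<Omega> (pd a f)"
  using C_closure_bcont C_closure_SucD(2) by blast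

text \<open>Expanding \<open>\<chi>\<close> in the standard basis makes the sum and scaling rules
  for \<open>bcont\<close> and for derivatives applicable.\<close>

lemma grad_eq_sum: "grad f x = (\<Sum>a\<in>UNIV. pd a f x *\<^sub>R axis a 1)"
  by (simp add: grad_def vec_eq_iff axis_def if_distrib sum.delta cong: if_cong)

lemma inner_grad: "grad f x \<bullet> v = (\<Sum>a\<in>UNIV. pd a f x * v $ a)"
  by (simp add: grad_def inner_vec_def)

lemma bcont_grad: "bounded \<Omega> \<Longrightarrow> C_closure (Suc r) \<Omega> f \<Longrightarrow> bcont \<Omega> (grad f)"
  unfolding grad_eq_sum[abs_def] by (intro bcont_intros bcont_pd)

lemma bcont_divg: "bounded \<Omega> \<Longrightarrow> C_closure (Suc r) \<Omega> F \<Longrightarrow> bcont \<Omega> (divg F)"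
  unfolding divg_def[abs_def] by (intro bcont_intros bcont_pd)

lemma bcont_convect:
  "bounded \<Omega> \<Longrightarrow> C_closure (Suc r) \<Omega> u \<Longrightarrow> bcont \<Omega> v \<Longrightarrow> bcont \<Omega> (\<lambda>x. convect (v x) u x)"
  unfolding convect_def by (intro bcont_intros bcont_pd)

lemma divg_scaleR:
  assumes "f differentiable (at x)" and "F differentiable (at x)"
  shows "divg (\<lambda>y. f y *\<^sub>R F y) x = grad f x \<bullet> F x + f x * divg F x"
proof -
  obtain D E where D: "(f has_derivative D) (at x)" and E: "(F has_derivative E) (at x)"
    using assms by (auto simp: differentiable_def)
  have "pd a (\<lambda>y. f y *\<^sub>R F y) x = f x *\<^sub>R pd a F x + pd a f x *\<^sub>R F x" for a
    using pd_eq[OF has_derivative_scaleR[OF D E]] by (simp add: pd_eq[OF D] pd_eq[OF E])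
  then show ?thesis
    by (simp add: divg_def inner_grad sum.distrib sum_distrib_left)
qed

text \<open>The product rule leaves only values and first derivatives of the two factors.\<close>

lemma bcont_divg_scaleR:
  assumes "bounded \<Omega>" and "C_closure (Suc r) \<Omega> f" and "C_closure (Suc s) \<Omega> F"
  shows "bcont \<Omega> (divg (\<lambda>y. f y *\<^sub>R F y))"
proof (subst bcont_cong)
  show "divg (\<lambda>y. f y *\<^sub>R F y) x = grad f x \<bullet> F x + f x * divg F x" if "x \<in> \<Omega>" for x
    using that assms(2,3) by (intro divg_scaleR C_closure_SucD(1))
  show "bcont \<Omega> (\<lambda>x. grad f x \<bullet> F x + f x * divg F x)"
    using assms by (intro bcont_intros bcont_grad bcont_divg C_closure_bcont)
qed

text \<open>The right-hand side is a multiple of the Laplacian; the derivative of the gradient is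
  assembled from those of the \<open>pd a f\<close>.\<close>

lemma divg_grad:
  assumes "\<And>a. pd a f differentiable (at x)"
  shows "divg (\<lambda>y. r *\<^sub>R grad f y) x = r * (\<Sum>a\<in>UNIV. pd a (pd a f) x)"
proof -
  obtain D where D: "\<And>a. (pd a f has_derivative D a) (at x)"
    using assms unfolding differentiable_def by metis
  have "((\<lambda>y. r *\<^sub>R grad f y) has_derivative (\<lambda>h. r *\<^sub>R (\<Sum>a\<in>UNIV. D a h *\<^sub>R axis a 1))) (at x)"
    unfolding grad_eq_sum[abs_def] by (intro derivative_intros D)
  then have "pd b (\<lambda>y. r *\<^sub>R grad f y) x $ b = r * pd b (pd b f) x" for b
    by (simp add: pd_eq pd_eq[OF D] axis_def if_distrib sum.delta cong: if_cong)
  then show ?thesis by (simp add: divg_def sum_distrib_left)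
qed

lemma bcont_divg_grad:
  assumes "bounded \<Omega>" and "C_closure (Suc (Suc r)) \<Omega> f"
  shows "bcont \<Omega> (divg (\<lambda>y. s *\<^sub>R grad f y))"
proof (subst bcont_cong)
  have C1: "C_closure (Suc r) \<Omega> (pd a f)" for a
    using assms(2) by (rule C_closure_SucD(2))
  show "divg (\<lambda>y. s *\<^sub>R grad f y) x = s * (\<Sum>a\<in>UNIV. pd a (pd a f) x)" if "x \<in> \<Omega>" for x
    using that C1 by (intro divg_grad C_closure_SucD(1))
  show "bcont \<Omega> (\<lambda>x. s * (\<Sum>a\<in>UNIV. pd a (pd a f) x))"
    using assms(1) C1 by (intro bcont_intros bcont_pd)
qed

section \<open>Convection and viscous dissipation\<close>

lemma convect_add: "convect (v + w) u x = convect v u x + convect w u x"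
  by (simp add: convect_def scaleR_left_distrib sum.distrib)

lemma convect_scaleR: "convect (r *\<^sub>R v) u x = r *\<^sub>R convect v u x"
  by (simp add: convect_def scaleR_sum_right)

lemma convect_sum: "convect (\<Sum>i\<in>I. v i) u x = (\<Sum>i\<in>I. convect (v i) u x)"
  unfolding convect_def by (subst sum.swap) (simp add: sum_distrib_right scaleR_sum_left)

text \<open>This links the two balances: convection tested with its own velocity is half the
  transport of the squared speed.\<close>

lemma grad_inner_self:
  assumes "u differentiable (at x)"
  shows "grad (\<lambda>y. u y \<bullet> u y) x \<bullet> v = 2 * (u x \<bullet> convect v u x)"
proof -
  obtain D where D: "(u has_derivative D) (at x)"
    using assms by (auto simp: differentiable_def)
  have "pd a (\<lambda>y. u y \<bullet> u y) x = 2 * (u x \<bullet> pd a u x)" for a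
    using pd_eq[OF has_derivative_inner[OF D D]] by (simp add: pd_eq[OF D] inner_commute)
  then show ?thesis
    by (simp add: inner_grad convect_def inner_sum_right sum_distrib_left mult_ac)
qed

text \<open>A symmetric matrix has the same Frobenius product with a matrix and with its transpose,
  so twice the pairing is the squared norm of \<open>sym_grad u x\<close>.\<close>

lemma sym_grad_inner_vgrad_nonneg: "0 \<le> sym_grad u x \<bullet> vgrad u x"
proof -
  have "sym_grad u x \<bullet> transpose (vgrad u x) = sym_grad u x \<bullet> vgrad u x"
    by (subst (1 2) inner_vec_def, simp add: inner_vec_def, subst sum.swap)
      (simp add: sym_grad_def transpose_def add.commute)
  then have "2 * (sym_grad u x \<bullet> vgrad u x) = sym_grad u x \<bullet> sym_grad u x"
    by (simp add: sym_grad_def inner_add_right)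
  then show ?thesis using inner_ge_zero[of "sym_grad u x"] by linarith
qed

section \<open>Telescoping and quadratic forms\<close>

lemma sum_telescope_pred:
  fixes F :: "nat \<Rightarrow> 'a::ab_group_add"
  shows "(\<Sum>m=1..M. F m - F (m - 1)) = F M - F 0"
  by (induction M) auto

text \<open>The form is tested with the unit vector at \<open>m\<close>.\<close>

lemma diag_nonneg_of_quadratic_form:
  fixes c :: "nat \<Rightarrow> nat \<Rightarrow> real"
  assumes "\<And>v. 0 \<le> (\<Sum>i=1..M. \<Sum>j=1..M. c i j * v i * v j)" and "m \<in> {1..M}"
  shows "0 \<le> c m m"
proof -
  \<comment> \<open>Nested conditionals let \<open>sum.delta\<close> collapse one sum at a
    time.\<close>
  have "c i j * (if i = m then 1 else 0) * (if j = m then 1 else 0)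
      = (if i = m then if j = m then c m m else 0 else 0)" for i j by simp
  moreover have "(\<Sum>j=1..M. if i = m then if j = m then c m m else 0 else 0)
      = (if i = m then c m m else 0)" for i
    using assms(2) by (simp add: sum.delta)
  ultimately show ?thesis
    using assms(1)[of "\<lambda>i. if i = m then 1 else 0"] assms(2) by (simp add: sum.delta)
qed

text \<open>Entries of \<open>b\<close> are replaced by those of \<open>a\<close> in the order of
  their indices. Replacing entry \<open>m\<close> changes the form by twice the pairing of its
  increment with the updated vector, less \<open>c m m\<close> times the squared increment.\<close>

lemma quadratic_form_sequential_le:
  fixes c :: "nat \<Rightarrow> nat \<Rightarrow> real" and a b :: "nat \<Rightarrow> 'a::real_inner"
  assumes sym: "\<And>i j. i \<in> {1..M} \<Longrightarrow> j \<in> {1..M} \<Longrightarrow> c i j = c j i"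
    and diag: "\<And>i. i \<in> {1..M} \<Longrightarrow> 0 \<le> c i i"
  shows "(\<Sum>i=1..M. \<Sum>j=1..M. c i j * (a i \<bullet> a j)) - (\<Sum>i=1..M. \<Sum>j=1..M. c i j * (b i \<bullet> b j))
    \<le> 2 * (\<Sum>i=1..M. \<Sum>j=1..M. c i j * ((a i - b i) \<bullet> (if j \<le> i then a j else b j)))"
proof -
  define z where "z m j = (if j \<le> m then a j else b j)" for m j :: nat
  define q where "q m = (\<Sum>i=1..M. \<Sum>j=1..M. c i j * (z m i \<bullet> z m j))" for m
  have step: "q m - q (m - 1) \<le> 2 * (\<Sum>j=1..M. c m j * ((a m - b m) \<bullet> z m j))"
    if m: "m \<in> {1..M}" for m
  proof -
    define d where "d = a m - b m"
    define y where "y = z (m - 1)"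
    \<comment> \<open>Stage \<open>m\<close> differs from stage \<open>m - 1\<close> in entry
      \<open>m\<close> alone.\<close>
    have z: "z m i = y i + (if i = m then d else 0)" for i
      using m by (auto simp: z_def y_def d_def)
    have "q m = q (m - 1) + (\<Sum>i=1..M. c i m * (y i \<bullet> d)) + (\<Sum>j=1..M. c m j * (d \<bullet> y j))
        + c m m * (d \<bullet> d)"
    proof -
      have "c i j * (z m i \<bullet> z m j) = c i j * (y i \<bullet> y j) + (if j = m then c i m * (y i \<bullet> d) else 0)
          + (if i = m then c m j * (d \<bullet> y j) else 0)
          + (if i = m then if j = m then c m m * (d \<bullet> d) else 0 else 0)" for i j
        by (simp add: z inner_add_left inner_add_right distrib_left)
      moreover have "(\<Sum>j=1..M. if i = m then F j else 0) = (if i = m then \<Sum>j=1..M. F j else 0)"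
        for i and F :: "nat \<Rightarrow> real" by simp
      ultimately show ?thesis
        using m by (simp add: q_def y_def sum.distrib sum.delta)
    qed
    moreover have "(\<Sum>i=1..M. c i m * (y i \<bullet> d)) = (\<Sum>j=1..M. c m j * (d \<bullet> y j))"
      using m sym by (intro sum.cong) (auto simp: inner_commute)
    \<comment> \<open>Pairing with the updated \<open>z m\<close> counts the squared increment once,
      hence twice after doubling, while \<open>q\<close> gains it only once; the excess is
      nonnegative.\<close>
    moreover have "(\<Sum>j=1..M. c m j * (d \<bullet> z m j)) = (\<Sum>j=1..M. c m j * (d \<bullet> y j)) + c m m * (d \<bullet> d)"
    proof -
      have "c m j * (d \<bullet> z m j) = c m j * (d \<bullet> y j) + (if j = m then c m m * (d \<bullet> d) else 0)" for j
        by (simp add: z inner_add_right distrib_left)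
      then show ?thesis using m by (simp add: sum.distrib sum.delta)
    qed
    moreover have "0 \<le> c m m * (d \<bullet> d)"
      using diag[OF m] by simp
    ultimately show ?thesis by (simp add: d_def)
  qed
  have "q M - q 0 = (\<Sum>m=1..M. q m - q (m - 1))"
    by (rule sum_telescope_pred[symmetric])
  also have "\<dots> \<le> (\<Sum>m=1..M. 2 * (\<Sum>j=1..M. c m j * ((a m - b m) \<bullet> z m j)))"
    by (intro sum_mono step)
  finally have "q M - q 0 \<le> 2 * (\<Sum>m=1..M. \<Sum>j=1..M. c m j * ((a m - b m) \<bullet> z m j))"
    by (simp add: sum_distrib_left)
  \<comment> \<open>Indices start at 1, so stage \<open>M\<close> has replaced every entry and stage
    0 none.\<close>
  moreover have "q M = (\<Sum>i=1..M. \<Sum>j=1..M. c i j * (a i \<bullet> a j))"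
    unfolding q_def z_def by (intro sum.cong) auto
  moreover have "q 0 = (\<Sum>i=1..M. \<Sum>j=1..M. c i j * (b i \<bullet> b j))"
    unfolding q_def z_def by (intro sum.cong) auto
  ultimately show ?thesis by (simp add: z_def)
qed

theorem theorem3p2:
  fixes \<Omega> :: "(real^'d::finite) set"
    and P :: pr_fluid
    and M k :: nat
    and dt :: real
    and n :: "nat \<Rightarrow> nat \<Rightarrow> real^'d \<Rightarrow> real"
    and u :: "nat \<Rightarrow> real^'d \<Rightarrow> real^'d"
    and H :: "real \<Rightarrow> real"
    and mu :: "nat \<Rightarrow> real^'d \<Rightarrow> real"
    and us J :: "nat \<Rightarrow> real^'d \<Rightarrow> real^'d"
    and uss :: "real^'d \<Rightarrow> real^'d"
    and mob :: "nat \<Rightarrow> real^'d \<Rightarrow> real"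
    and eta xi lam :: "real^'d \<Rightarrow> real"
    and c :: "nat \<Rightarrow> nat \<Rightarrow> real"
    and CT Mw N :: "nat \<Rightarrow> real"
    and Q :: real
  assumes "CARD('d) \<le> 3"
    and "open \<Omega>" "bounded \<Omega>" "connected \<Omega>" "C1_boundary \<Omega>"
    and "1 \<le> M" and "0 < dt"
    \<comment> \<open>constants of the fluid\<close>
    and "0 < pr_R P" "0 < pr_T P"
    and "\<And>i. i \<in> {1..M} \<Longrightarrow> 0 < pr_Tc P i \<and> 0 < pr_Pc P i"
    and "\<And>i. i \<in> {1..M} \<Longrightarrow> 0 < Mw i"
    and "\<And>i. i \<in> {1..M} \<Longrightarrow> 0 \<le> CT i"
    and "\<And>i j. i \<in> {1..M} \<Longrightarrow> j \<in> {1..M} \<Longrightarrow> c i j = c j i"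
    and "\<And>v. 0 \<le> (\<Sum>i=1..M. \<Sum>j=1..M. c i j * v i * v j)"
    \<comment> \<open>regularity of the fields\<close>
    and "\<And>i. i \<in> {1..M} \<Longrightarrow> C_closure 2 \<Omega> (n k i) \<and> C_closure 2 \<Omega> (n (Suc k) i)"
    and "\<And>i. i \<in> {1..M} \<Longrightarrow> C_closure 2 \<Omega> (mu i)"
    and "C_closure 1 \<Omega> (u k)" "C_closure 2 \<Omega> (u (Suc k))"
    and "\<And>i. i \<le> M \<Longrightarrow> C_closure 1 \<Omega> (us i)"
    and "\<And>i. i \<in> {1..M} \<Longrightarrow> C_closure 1 \<Omega> (mob i)"
    and "C_closure 1 \<Omega> eta" "C_closure 1 \<Omega> xi"
    \<comment> \<open>admissibility of densities and coefficients\<close>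
    and "\<And>i x. i < M \<Longrightarrow> x \<in> \<Omega> \<Longrightarrow> n_frac n k i x \<in> f_b_domain P M"
    and "set_integrable lborel \<Omega> (\<lambda>x. f_b P M (\<lambda>j. n k j x))"
    and "\<And>i. i \<in> {1..M} \<Longrightarrow> set_integrable lborel \<Omega>
           (\<lambda>x. mu_b P M i (n_frac n k (i - 1) x) * (n (Suc k) i x - n k i x))"
    and "\<And>x. x \<in> \<Omega> \<Longrightarrow> 0 < rho M Mw (n k) x"
    and "\<And>i x. i \<in> {1..M} \<Longrightarrow> x \<in> \<Omega> \<Longrightarrow> 0 \<le> mob i x"
    and "\<And>x. lam x = xi x - 2/3 * eta x"
    and "\<And>x. x \<in> \<Omega> \<Longrightarrow> 0 < eta x \<and> 0 < lam x"
    and "\<And>i. N i = moles \<Omega> (n k i)"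
    and "0 < F_b P M \<Omega> (n k) + (\<Sum>j=1..M. CT j * N j)"
    and "Q = sqrt (F_b P M \<Omega> (n k) + (\<Sum>j=1..M. CT j * N j))"
    \<comment> \<open>(i) chemical potentials and scalar auxiliary variable\<close>
    and "\<And>i x. i \<in> {1..M} \<Longrightarrow> x \<in> \<Omega> \<Longrightarrow>
           mu i x = (H (real k + real i / real M) + H (real k + real (i - 1) / real M)) / (2 * Q)
               * mu_b P M i (n_frac n k (i - 1) x)
             - (\<Sum>j=1..i. divg (\<lambda>y. c i j *\<^sub>R grad (n (Suc k) j) y) x)
             - (\<Sum>j=i+1..M. divg (\<lambda>y. c i j *\<^sub>R grad (n k j) y) x)"
    and "\<And>i. i \<in> {1..M} \<Longrightarrow>
           (H (real k + real i / real M) - H (real k + real (i - 1) / real M)) / dt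
           = (LINT x:\<Omega>|lborel. mu_b P M i (n_frac n k (i - 1) x) / (2 * Q)
                * ((n (Suc k) i x - n k i x) / dt))"
    \<comment> \<open>(ii) intermediate velocities\<close>
    and "\<And>x. x \<in> \<Omega> \<Longrightarrow> us 0 x = u k x"
    and "\<And>i x. i \<in> {1..M} \<Longrightarrow> x \<in> \<Omega> \<Longrightarrow>
           us i x = us (i - 1) x - (dt / rho M Mw (n k) x * n k i x) *\<^sub>R grad (mu i) x"
    and "\<And>x. x \<in> \<Omega> \<Longrightarrow>
           uss x = (\<Sum>i=1..M. (Mw i * n k i x / rho M Mw (n k) x) *\<^sub>R us i x)"
    \<comment> \<open>(iii) mass balance\<close>
    and "\<And>i x. i \<in> {1..M} \<Longrightarrow> x \<in> \<Omega> \<Longrightarrow>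
           (n (Suc k) i x - n k i x) / dt + divg (\<lambda>y. n k i y *\<^sub>R us i y) x + divg (J i) x = 0"
    and "\<And>i x. i \<in> {1..M} \<Longrightarrow> x \<in> \<Omega> \<Longrightarrow> J i x = - (mob i x *\<^sub>R grad (mu i) x)"
    \<comment> \<open>(iv) momentum balance\<close>
    and "\<And>x. x \<in> \<Omega> \<Longrightarrow>
           (rho M Mw (n k) x / dt) *\<^sub>R (u (Suc k) x - us M x)
           + rho M Mw (n k) x *\<^sub>R convect (uss x) (u (Suc k)) x
           + (\<Sum>i=1..M. Mw i *\<^sub>R convect (J i x) (u (Suc k)) x)
           = viscous lam eta (u (Suc k)) x"
    \<comment> \<open>boundary convention\<close>
    and "\<And>\<phi> i j m. \<phi> \<in> scheme_scalars M (n k) (n (Suc k)) mu (u (Suc k)) \<Longrightarrow>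
           i \<in> {1..M} \<Longrightarrow> j \<in> {1..M} \<Longrightarrow> m \<in> {k, Suc k} \<Longrightarrow>
           ibp \<Omega> \<phi> (\<lambda>x. c i j *\<^sub>R grad (n m j) x)"
    and "\<And>\<phi> i. \<phi> \<in> scheme_scalars M (n k) (n (Suc k)) mu (u (Suc k)) \<Longrightarrow> i \<in> {1..M} \<Longrightarrow>
           ibp \<Omega> \<phi> (\<lambda>x. n k i x *\<^sub>R us i x)"
    and "\<And>\<phi> i. \<phi> \<in> scheme_scalars M (n k) (n (Suc k)) mu (u (Suc k)) \<Longrightarrow> i \<in> {1..M} \<Longrightarrow>
           ibp \<Omega> \<phi> (J i)"
    and "ibp_viscous \<Omega> lam eta (u (Suc k)) (u (Suc k))"
  shows "kinetic \<Omega> M Mw (n (Suc k)) (u (Suc k))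
           + helmholtz \<Omega> M c CT N (n (Suc k)) (H (real (Suc k)))
         \<le> kinetic \<Omega> M Mw (n k) (u k) + helmholtz \<Omega> M c CT N (n k) (H (real k))"
proof -
  note \<Omega> = assms(2,3) and M = assms(6) and dt = assms(7) and n_C2 = assms(15)[unfolded numeral_2_eq_2]
    and mu_C2 = assms(16)[unfolded numeral_2_eq_2]
    and w_C2 = assms(18) and us_C1 = assms(19)[unfolded One_nat_def] and mob_C1 = assms(20) and rho_pos = assms(26)
    and mob_nonneg = assms(27) and coeffs_pos = assms(29) and us_step = assms(36) and J_eq = assms(39)
  define I where "I = (\<lambda>f::real^'d \<Rightarrow> real. LINT x:\<Omega>|lborel. f x)"
  define r where "r = rho M Mw (n k)"
  define w where "w = u (Suc k)"
  define h where "h i = H (real k + real i / real M)" for i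
  define \<delta> where "\<delta> i x = n (Suc k) i x - n k i x" for i x
  \<comment> \<open>The gradient of component \<open>j\<close> as it enters the divergence terms of
    \<open>mu i\<close>: new up to index \<open>i\<close>, old beyond.\<close>
  define g where "g i j = (if j \<le> i then grad (n (Suc k) j) else grad (n k j))" for i j
  define e where "e i x = grad (n (Suc k) i) x - grad (n k i) x" for i x
  define f where "f i x = n k i x *\<^sub>R us i x" for i x
  define S where "S = scheme_scalars M (n k) (n (Suc k)) mu w"

  \<comment> \<open>Integration over \<open>\<Omega>\<close>\<close>
  have I_add: "I (\<lambda>x. p x + q x) = I p + I q" and I_diff: "I (\<lambda>x. p x - q x) = I p - I q"
    if "bcont \<Omega> p" "bcont \<Omega> q" for p q
    using that unfolding I_def
    by (simp_all only: set_integral_add(2) set_integral_diff(2) bcont_set_integrable[OF \<Omega>])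
  \<comment> \<open>Scaling holds for every field: if \<open>p\<close> is not integrable, both sides
    are 0. Integrands containing \<open>mu_b\<close> are scaled this way below.\<close>
  have I_mult: "I (\<lambda>x. s * p x) = s * I p" and I_divide: "I (\<lambda>x. p x / s) = I p / s" for s p
    by (simp_all add: I_def)
  have I_sum: "I (\<lambda>x. \<Sum>i\<in>A. p i x) = (\<Sum>i\<in>A. I (p i))"
    if "\<And>i. i \<in> A \<Longrightarrow> bcont \<Omega> (p i)" for A :: "nat set" and p
    using that
  proof (induction A rule: infinite_finite_induct)
    case (insert j A)
    then show ?case by (simp add: I_add bcont_sum)
  qed (simp_all add: I_def)
  have I_cong: "I p = I q" if "\<And>x. x \<in> \<Omega> \<Longrightarrow> p x = q x" for p q
    unfolding I_def using that \<Omega>(1) by (intro set_lebesgue_integral_cong) auto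
  have I_mono: "I p \<le> I q" if "bcont \<Omega> p" "bcont \<Omega> q" "\<And>x. x \<in> \<Omega> \<Longrightarrow> p x \<le> q x" for p q
    unfolding I_def using that bcont_set_integrable[OF \<Omega>] by (intro set_integral_mono)

  \<comment> \<open>Regularity of the fields of the scheme\<close>
  have n_bc: "bcont \<Omega> (n k i)" "bcont \<Omega> (n (Suc k) i)" and gn_bc: "bcont \<Omega> (grad (n k i))"
      "bcont \<Omega> (grad (n (Suc k) i))" if "i \<in> {1..M}" for i
    using n_C2[OF that] \<Omega>(2) by (blast intro: C_closure_bcont bcont_grad)+
  have mu_bc: "bcont \<Omega> (mu i)" "bcont \<Omega> (grad (mu i))" if "i \<in> {1..M}" for i
    using mu_C2[OF that] \<Omega>(2) by (blast intro: C_closure_bcont bcont_grad)+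
  have us_bc: "bcont \<Omega> (us i)" if "i \<le> M" for i
    using us_C1[OF that] \<Omega>(2) by (rule C_closure_bcont[rotated])
  have mob_bc: "bcont \<Omega> (mob i)" if "i \<in> {1..M}" for i
    using mob_C1[OF that] \<Omega>(2) by (rule C_closure_bcont[rotated])
  have w_C: "C_closure (Suc (Suc 0)) \<Omega> w"
    using w_C2 by (simp only: w_def numeral_2_eq_2)
  have w_bc: "bcont \<Omega> w"
    using \<Omega>(2) w_C by (rule C_closure_bcont)
  have r_bc: "bcont \<Omega> r"
    unfolding r_def rho_def[abs_def] by (intro bcont_intros n_bc)
  have \<delta>_bc: "bcont \<Omega> (\<delta> i)" if "i \<in> {1..M}" for i
    unfolding \<delta>_def[abs_def] by (intro bcont_intros n_bc that)
  have e_bc: "bcont \<Omega> (e i)" if "i \<in> {1..M}" for i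
    unfolding e_def[abs_def] by (intro bcont_intros gn_bc that)
  have g_bc: "bcont \<Omega> (g i j)" and dg_bc: "bcont \<Omega> (divg (\<lambda>y. s *\<^sub>R g i j y))"
    if "j \<in> {1..M}" for i j s
    using gn_bc[OF that] n_C2[OF that] bcont_divg_grad[OF \<Omega>(2)] by (auto simp: g_def simp del: C_closure.simps)
  have f_bc: "bcont \<Omega> (f i)" if "i \<in> {1..M}" for i
    unfolding f_def[abs_def] using that by (intro bcont_intros n_bc us_bc) auto
  have J_bc: "bcont \<Omega> (J i)" if "i \<in> {1..M}" for i
  proof (subst bcont_cong)
    show "J i x = - (mob i x *\<^sub>R grad (mu i) x)" if "x \<in> \<Omega>" for x
      using J_eq \<open>i \<in> {1..M}\<close> that by blast
    show "bcont \<Omega> (\<lambda>x. - (mob i x *\<^sub>R grad (mu i) x))"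
      by (intro bcont_intros mob_bc mu_bc that)
  qed
  have df_bc: "bcont \<Omega> (divg (f i))" if "i \<in> {1..M}" for i
    unfolding f_def[abs_def] using that n_C2[OF that] us_C1[of i]
    by (auto intro!: bcont_divg_scaleR[OF \<Omega>(2)] simp del: C_closure.simps)

  \<comment> \<open>Mass balance, pointwise and in weak form\<close>
  have mass: "\<delta> i x = - dt * (divg (f i) x + divg (J i) x)" if "i \<in> {1..M}" "x \<in> \<Omega>" for i x
    using assms(38)[OF that] dt unfolding \<delta>_def f_def[abs_def] by (simp add: field_simps)
  \<comment> \<open>The regularity of its divergence is
    read off the mass balance, as is that of the viscous force below off the momentum balance.\<close>
  have dJ_bc: "bcont \<Omega> (divg (J i))" if "i \<in> {1..M}" for i
  proof (subst bcont_cong)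
    show "divg (J i) x = - (1 / dt) * \<delta> i x - divg (f i) x" if "x \<in> \<Omega>" for x
      using mass[OF \<open>i \<in> {1..M}\<close> that] dt by (simp add: field_simps)
    show "bcont \<Omega> (\<lambda>x. - (1 / dt) * \<delta> i x - divg (f i) x)"
      by (intro bcont_intros \<delta>_bc df_bc that)
  qed

  \<comment> \<open>The regularity of \<open>grad \<phi>\<close> is requested only through its
    pairings, because for the squared speed these are known as convective derivatives.\<close>
  have mass_test: "I (\<lambda>x. \<phi> x * \<delta> i x) = dt * I (\<lambda>x. grad \<phi> x \<bullet> (f i x + J i x))"
    if i: "i \<in> {1..M}" and S: "\<phi> \<in> S" and bc: "bcont \<Omega> \<phi>"
      and gbc: "\<And>v. bcont \<Omega> v \<Longrightarrow> bcont \<Omega> (\<lambda>x. grad \<phi> x \<bullet> v x)" for \<phi> i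
  proof -
    have "I (\<lambda>x. \<phi> x * \<delta> i x) = I (\<lambda>x. - dt * (\<phi> x * divg (f i) x + \<phi> x * divg (J i) x))"
      by (rule I_cong) (simp add: mass[OF i] algebra_simps)
    also have "\<dots> = - dt * (I (\<lambda>x. \<phi> x * divg (f i) x) + I (\<lambda>x. \<phi> x * divg (J i) x))"
      using bc i by (subst I_mult, subst I_add) (auto intro!: bcont_intros df_bc dJ_bc)
    also have "I (\<lambda>x. \<phi> x * divg (f i) x) = - I (\<lambda>x. grad \<phi> x \<bullet> f i x)"
      using assms(42)[of \<phi> i] S i by (simp add: S_def w_def ibp_def I_def f_def[abs_def])
    also have "I (\<lambda>x. \<phi> x * divg (J i) x) = - I (\<lambda>x. grad \<phi> x \<bullet> J i x)"
      using assms(43)[of \<phi> i] S i by (simp add: S_def w_def ibp_def I_def)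
    also have "- dt * (- I (\<lambda>x. grad \<phi> x \<bullet> f i x) + - I (\<lambda>x. grad \<phi> x \<bullet> J i x))
        = dt * I (\<lambda>x. grad \<phi> x \<bullet> (f i x + J i x))"
      unfolding inner_add_right using i
      by (subst I_add) (auto intro!: gbc f_bc J_bc simp: algebra_simps)
    finally show ?thesis .
  qed

  \<comment> \<open>Increment of the scalar auxiliary variable\<close>
  have SAV: "(h i)\<^sup>2 - (h (i - 1))\<^sup>2
      = I (\<lambda>x. mu i x * \<delta> i x) - I (\<lambda>x. \<Sum>j=1..M. c i j * (e i x \<bullet> g i j x))"
    if i: "i \<in> {1..M}" for i
  proof -
    have ibp_\<delta>: "I (\<lambda>x. \<delta> i x * divg (\<lambda>y. c i j *\<^sub>R g i j y) x) = - I (\<lambda>x. c i j * (e i x \<bullet> g i j x))"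
      if j: "j \<in> {1..M}" for j
    proof -
      define G where "G y = c i j *\<^sub>R g i j y" for y
      have "ibp \<Omega> \<phi> G" if "\<phi> \<in> S" for \<phi>
        using assms(41)[of \<phi> i j k] assms(41)[of \<phi> i j "Suc k"] i j that
        by (auto simp: S_def w_def G_def[abs_def] g_def)
      \<comment> \<open>The boundary convention speaks of the two densities; linearity carries the
        integration by parts over to their difference.\<close>
      moreover have "n (Suc k) i \<in> S" "n k i \<in> S"
        using i by (auto simp: S_def scheme_scalars_def)
      ultimately have "I (\<lambda>x. n (Suc k) i x * divg G x) = - I (\<lambda>x. grad (n (Suc k) i) x \<bullet> G x)"
        "I (\<lambda>x. n k i x * divg G x) = - I (\<lambda>x. grad (n k i) x \<bullet> G x)"
        by (auto simp: ibp_def I_def)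
      moreover have "bcont \<Omega> G" "bcont \<Omega> (divg G)"
        unfolding G_def[abs_def] using j by (auto intro!: bcont_intros g_bc dg_bc)
      ultimately have "I (\<lambda>x. \<delta> i x * divg G x) = - I (\<lambda>x. e i x \<bullet> G x)"
        unfolding \<delta>_def e_def left_diff_distrib inner_diff_left
        using i by (subst (1 2) I_diff) (auto intro!: bcont_intros n_bc gn_bc)
      then show ?thesis by (simp add: G_def[abs_def])
    qed
    have mu_eq: "mu i x + (\<Sum>j=1..M. divg (\<lambda>y. c i j *\<^sub>R g i j y) x)
        = (h i + h (i - 1)) / (2 * Q) * mu_b P M i (n_frac n k (i - 1) x)" if "x \<in> \<Omega>" for x
    proof -
      \<comment> \<open>The sum is cut at \<open>i\<close>, where \<open>g i j\<close> passes from
        new to old densities.\<close>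
      have "{1..M} = {1..i} \<union> {i+1..M}" using i by auto
      then have "(\<Sum>j=1..M. divg (\<lambda>y. c i j *\<^sub>R g i j y) x)
          = (\<Sum>j=1..i. divg (\<lambda>y. c i j *\<^sub>R g i j y) x) + (\<Sum>j=i+1..M. divg (\<lambda>y. c i j *\<^sub>R g i j y) x)"
        by (simp add: sum.union_disjoint)
      also have "(\<Sum>j=1..i. divg (\<lambda>y. c i j *\<^sub>R g i j y) x)
          = (\<Sum>j=1..i. divg (\<lambda>y. c i j *\<^sub>R grad (n (Suc k) j) y) x)"
        by (intro sum.cong) (auto simp: g_def)
      also have "(\<Sum>j=i+1..M. divg (\<lambda>y. c i j *\<^sub>R g i j y) x)
          = (\<Sum>j=i+1..M. divg (\<lambda>y. c i j *\<^sub>R grad (n k j) y) x)"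
        by (intro sum.cong) (auto simp: g_def)
      finally show ?thesis
        using assms(33)[OF i that] by (simp add: h_def)
    qed
    have "h i - h (i - 1) = dt * I (\<lambda>x. mu_b P M i (n_frac n k (i - 1) x) / (2 * Q) * (\<delta> i x / dt))"
      using assms(34)[OF i] dt by (simp add: h_def \<delta>_def I_def field_simps)
    \<comment> \<open>In the difference of squares, the factor \<open>h i + h (i - 1)\<close> is the
      one that \<open>mu_b\<close> carries in the chemical potential, so the product recovers that
      bulk term.\<close>
    then have "(h i)\<^sup>2 - (h (i - 1))\<^sup>2
        = (h i + h (i - 1)) * dt * I (\<lambda>x. mu_b P M i (n_frac n k (i - 1) x) / (2 * Q) * (\<delta> i x / dt))"
      by (simp add: square_diff_square_factored power2_eq_square)
    also have "\<dots> = I (\<lambda>x. mu i x * \<delta> i x + (\<Sum>j=1..M. \<delta> i x * divg (\<lambda>y. c i j *\<^sub>R g i j y) x))"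
    \<comment> \<open>The bulk term is traded pointwise for \<open>mu i\<close> and the divergences
      before the integral is split, so that only \<open>bcont\<close> fields are split.\<close>
    proof (subst I_mult[symmetric], rule I_cong)
      fix x assume x: "x \<in> \<Omega>"
      have "(h i + h (i - 1)) * dt * (mu_b P M i (n_frac n k (i - 1) x) / (2 * Q) * (\<delta> i x / dt))
          = (h i + h (i - 1)) / (2 * Q) * mu_b P M i (n_frac n k (i - 1) x) * \<delta> i x"
        using dt by simp
      then show "(h i + h (i - 1)) * dt * (mu_b P M i (n_frac n k (i - 1) x) / (2 * Q) * (\<delta> i x / dt))
          = mu i x * \<delta> i x + (\<Sum>j=1..M. \<delta> i x * divg (\<lambda>y. c i j *\<^sub>R g i j y) x)"
        unfolding mu_eq[OF x, symmetric] by (simp add: sum_distrib_left algebra_simps)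
    qed
    also have "\<dots> = I (\<lambda>x. mu i x * \<delta> i x)
        + (\<Sum>j=1..M. I (\<lambda>x. \<delta> i x * divg (\<lambda>y. c i j *\<^sub>R g i j y) x))"
      using i by (subst I_add, (intro bcont_intros mu_bc \<delta>_bc dg_bc; simp)+, subst I_sum)
        (auto intro!: bcont_intros \<delta>_bc dg_bc)
    also have "(\<Sum>j=1..M. I (\<lambda>x. \<delta> i x * divg (\<lambda>y. c i j *\<^sub>R g i j y) x))
        = - (\<Sum>j=1..M. I (\<lambda>x. c i j * (e i x \<bullet> g i j x)))"
      by (simp add: ibp_\<delta> sum_negf)
    also have "(\<Sum>j=1..M. I (\<lambda>x. c i j * (e i x \<bullet> g i j x)))
        = I (\<lambda>x. \<Sum>j=1..M. c i j * (e i x \<bullet> g i j x))"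
      using i by (intro I_sum[symmetric] bcont_intros e_bc g_bc)
    finally show ?thesis by simp
  qed

  \<comment> \<open>Gradient energy and free energy\<close>
  have quad: "(\<Sum>i=1..M. \<Sum>j=1..M. c i j * (grad (n (Suc k) i) x \<bullet> grad (n (Suc k) j) x))
      - (\<Sum>i=1..M. \<Sum>j=1..M. c i j * (grad (n k i) x \<bullet> grad (n k j) x))
      \<le> 2 * (\<Sum>i=1..M. \<Sum>j=1..M. c i j * (e i x \<bullet> g i j x))" for x
  proof -
    have "g i j x = (if j \<le> i then grad (n (Suc k) j) x else grad (n k j) x)" for i j
      by (simp add: g_def)
    then show ?thesis
      unfolding e_def
      using quadratic_form_sequential_le[of M c "\<lambda>j. grad (n (Suc k) j) x" "\<lambda>j. grad (n k j) x",
          OF assms(13) diag_nonneg_of_quadratic_form[OF assms(14)]] by simp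
  qed
  have free: "helmholtz \<Omega> M c CT N (n (Suc k)) (H (real (Suc k)))
      - helmholtz \<Omega> M c CT N (n k) (H (real k)) \<le> (\<Sum>i=1..M. I (\<lambda>x. mu i x * \<delta> i x))"
  proof -
    \<comment> \<open>The last stage is the new time because \<open>1 \<le> M\<close> gives
      \<open>real M / real M = 1\<close>.\<close>
    have h_ends: "H (real (Suc k)) = h M" "H (real k) = h 0"
      using M by (simp_all add: h_def add.commute)
    have "(h M)\<^sup>2 - (h 0)\<^sup>2 = (\<Sum>i=1..M. (h i)\<^sup>2 - (h (i - 1))\<^sup>2)"
      by (rule sum_telescope_pred[symmetric])
    also have "\<dots> = (\<Sum>i=1..M. I (\<lambda>x. mu i x * \<delta> i x))
        - I (\<lambda>x. \<Sum>i=1..M. \<Sum>j=1..M. c i j * (e i x \<bullet> g i j x))"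
      by (subst I_sum, (intro bcont_intros e_bc g_bc; assumption),
          subst sum_subtractf[symmetric], intro sum.cong refl SAV)
    finally have hh: "(h M)\<^sup>2 - (h 0)\<^sup>2 = \<dots>" .
    have "I (\<lambda>x. \<Sum>i=1..M. \<Sum>j=1..M. c i j * (grad (n (Suc k) i) x \<bullet> grad (n (Suc k) j) x))
        - I (\<lambda>x. \<Sum>i=1..M. \<Sum>j=1..M. c i j * (grad (n k i) x \<bullet> grad (n k j) x))
        \<le> 2 * I (\<lambda>x. \<Sum>i=1..M. \<Sum>j=1..M. c i j * (e i x \<bullet> g i j x))"
      by (subst I_diff[symmetric], (intro bcont_intros gn_bc; simp)+, subst I_mult[symmetric])
        (intro I_mono quad bcont_intros gn_bc e_bc g_bc; simp)
    \<comment> \<open>The terms \<open>CT i * N i\<close> are the same at both times and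
      cancel.\<close>
    then show ?thesis
      unfolding helmholtz_def h_ends power2_abs using hh by (simp add: I_def)
  qed

  \<comment> \<open>Work of the chemical potentials\<close>
  have mu_work: "(\<Sum>i=1..M. I (\<lambda>x. mu i x * \<delta> i x))
      \<le> 1/2 * I (\<lambda>x. r x * (norm (u k x))\<^sup>2) - 1/2 * I (\<lambda>x. r x * (norm (us M x))\<^sup>2)"
  proof -
    define K where "K i = 1/2 * I (\<lambda>x. r x * (us i x \<bullet> us i x))" for i
    have "I (\<lambda>x. mu i x * \<delta> i x) \<le> K (i - 1) - K i" if i: "i \<in> {1..M}" for i
    proof -
      have "I (\<lambda>x. mu i x * \<delta> i x) = dt * I (\<lambda>x. grad (mu i) x \<bullet> (f i x + J i x))"
        using i by (intro mass_test) (auto simp: S_def scheme_scalars_def intro!: mu_bc bcont_intros)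
      also have "\<dots> = I (\<lambda>x. dt * (grad (mu i) x \<bullet> (f i x + J i x)))"
        by (simp add: I_mult)
      also have "\<dots> \<le> I (\<lambda>x. 1/2 * (r x * (us (i - 1) x \<bullet> us (i - 1) x)) - 1/2 * (r x * (us i x \<bullet> us i x)))"
      proof (rule I_mono)
        fix x assume x: "x \<in> \<Omega>"
        have "r x > 0" using rho_pos x by (simp add: r_def)
        \<comment> \<open>Multiplying by the density clears the quotient in the velocity update;
          tested with \<open>us i x\<close>, the update expresses the work of the convective flux by
          the velocity jump.\<close>
        then have step: "r x *\<^sub>R (us (i - 1) x - us i x) = (dt * n k i x) *\<^sub>R grad (mu i) x"
          using us_step[OF i x] by (simp add: r_def)
        have "dt * (grad (mu i) x \<bullet> f i x) = r x * ((us (i - 1) x - us i x) \<bullet> us i x)"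
          using arg_cong[OF step, of "\<lambda>v. v \<bullet> us i x"] by (simp add: f_def)
        \<comment> \<open>Diffusion runs down the gradient of the chemical potential, so it only
          dissipates.\<close>
        moreover have "grad (mu i) x \<bullet> J i x \<le> 0"
          using J_eq[OF i x] mob_nonneg[OF i x] by (simp add: mult_nonneg_nonneg)
        ultimately have "dt * (grad (mu i) x \<bullet> (f i x + J i x)) \<le> r x * ((us (i - 1) x - us i x) \<bullet> us i x)"
          using dt by (simp add: inner_add_right distrib_left mult_nonneg_nonpos)
        \<comment> \<open>The two sides differ by half the squared velocity jump.\<close>
        also have "(us (i - 1) x - us i x) \<bullet> us i x
            \<le> 1/2 * (us (i - 1) x \<bullet> us (i - 1) x) - 1/2 * (us i x \<bullet> us i x)"
          using inner_ge_zero[of "us (i - 1) x - us i x"]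
          by (simp add: inner_diff_left inner_diff_right inner_commute)
        finally show "dt * (grad (mu i) x \<bullet> (f i x + J i x))
            \<le> 1/2 * (r x * (us (i - 1) x \<bullet> us (i - 1) x)) - 1/2 * (r x * (us i x \<bullet> us i x))"
          using \<open>r x > 0\<close> by (simp add: right_diff_distrib mult_left_mono algebra_simps)
      qed (use i in \<open>auto intro!: bcont_intros mu_bc f_bc J_bc r_bc us_bc\<close>)
      also have "\<dots> = K (i - 1) - K i"
        unfolding K_def using i
        by (subst I_diff) (auto intro!: bcont_intros r_bc us_bc simp: I_mult I_divide)
      finally show ?thesis .
    qed
    then have "(\<Sum>i=1..M. I (\<lambda>x. mu i x * \<delta> i x)) \<le> (\<Sum>i=1..M. K (i - 1) - K i)"
      by (intro sum_mono)
    also have "\<dots> = K 0 - K M"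
      \<comment> \<open>The summands are earlier minus later stage, hence the telescope of
        \<open>- K\<close>.\<close>
      using sum_telescope_pred[of "\<lambda>i. - K i" M] by simp
    also have "K 0 = 1/2 * I (\<lambda>x. r x * (norm (u k x))\<^sup>2)"
      unfolding K_def using assms(35) by (auto simp: dot_square_norm intro: I_cong)
    also have "K M = 1/2 * I (\<lambda>x. r x * (norm (us M x))\<^sup>2)"
      by (simp add: K_def dot_square_norm)
    finally show ?thesis .
  qed

  \<comment> \<open>Momentum balance and new kinetic energy\<close>
  have kin: "kinetic \<Omega> M Mw (n (Suc k)) w \<le> 1/2 * I (\<lambda>x. r x * (norm (us M x))\<^sup>2)"
  proof -
    define C where "C i x = w x \<bullet> convect (f i x + J i x) w x" for i x
    have C_bc: "bcont \<Omega> (C i)" if "i \<in> {1..M}" for i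
      unfolding C_def[abs_def]
      by (intro bcont_intros w_bc bcont_convect[OF \<Omega>(2) w_C] f_bc J_bc that)
    have w_diff: "w differentiable (at x)" if "x \<in> \<Omega>" for x
      using w_C that by (rule C_closure_SucD(1))
    \<comment> \<open>The factor 2 comes from the gradient of the squared speed and later cancels
      the 1/2 of the kinetic energy.\<close>
    have momentum_flux: "I (\<lambda>x. (w x \<bullet> w x) * \<delta> i x) = 2 * dt * I (C i)" if i: "i \<in> {1..M}" for i
    proof -
      have "I (\<lambda>x. (w x \<bullet> w x) * \<delta> i x) = dt * I (\<lambda>x. grad (\<lambda>y. w y \<bullet> w y) x \<bullet> (f i x + J i x))"
      proof (intro mass_test i)
        show "(\<lambda>y. w y \<bullet> w y) \<in> S" by (simp add: S_def scheme_scalars_def)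
        show "bcont \<Omega> (\<lambda>y. w y \<bullet> w y)" by (intro bcont_intros w_bc)
        show "bcont \<Omega> (\<lambda>x. grad (\<lambda>y. w y \<bullet> w y) x \<bullet> v x)" if v: "bcont \<Omega> v" for v
        proof (subst bcont_cong)
          show "grad (\<lambda>y. w y \<bullet> w y) x \<bullet> v x = 2 * (w x \<bullet> convect (v x) w x)" if "x \<in> \<Omega>" for x
            using w_diff[OF that] by (rule grad_inner_self)
          show "bcont \<Omega> (\<lambda>x. 2 * (w x \<bullet> convect (v x) w x))"
            by (intro bcont_intros w_bc bcont_convect[OF \<Omega>(2) w_C] v)
        qed
      qed
      also have "I (\<lambda>x. grad (\<lambda>y. w y \<bullet> w y) x \<bullet> (f i x + J i x)) = I (\<lambda>x. 2 * C i x)"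
        by (rule I_cong) (simp add: grad_inner_self[OF w_diff] C_def)
      finally show ?thesis by (simp add: I_mult)
    qed
    \<comment> \<open>\<open>V\<close> collects both transport terms of the momentum balance,
      convective and diffusive, tested with \<open>w\<close>.\<close>
    define V where "V x = (\<Sum>i=1..M. Mw i * C i x)" for x
    have V_bc: "bcont \<Omega> V"
      unfolding V_def[abs_def] by (intro bcont_intros C_bc)
    have momentum: "dt * V x = dt * (w x \<bullet> viscous lam eta w x) - r x * (w x \<bullet> (w x - us M x))"
      if x: "x \<in> \<Omega>" for x
    proof -
      have "r x > 0" using rho_pos x by (simp add: r_def)
      \<comment> \<open>The mass fractions as weights make \<open>r x\<close> times
        \<open>uss x\<close> the total convective mass flux.\<close>
      then have "r x *\<^sub>R uss x = (\<Sum>i=1..M. Mw i *\<^sub>R f i x)"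
        using assms(37)[OF x] by (simp add: r_def f_def scaleR_sum_right)
      then have "r x *\<^sub>R convect (uss x) w x = (\<Sum>i=1..M. Mw i *\<^sub>R convect (f i x) w x)"
        by (simp flip: convect_scaleR convect_sum)
      then have "V x = w x \<bullet> (r x *\<^sub>R convect (uss x) w x + (\<Sum>i=1..M. Mw i *\<^sub>R convect (J i x) w x))"
        by (simp add: V_def C_def convect_add inner_add_right inner_sum_right distrib_left sum.distrib)
      also have "\<dots> = w x \<bullet> (viscous lam eta w x - (r x / dt) *\<^sub>R (w x - us M x))"
        by (intro arg_cong[where f = "inner (w x)"])
          (simp add: w_def r_def algebra_simps flip: assms(40)[OF x])
      finally show ?thesis
        using dt by (simp add: inner_diff_right right_diff_distrib)
    qed
    have visc_bc: "bcont \<Omega> (\<lambda>x. w x \<bullet> viscous lam eta w x)"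
    proof (subst bcont_cong)
      show "w x \<bullet> viscous lam eta w x = V x + 1 / dt * (r x * (w x \<bullet> (w x - us M x)))" if "x \<in> \<Omega>" for x
        using momentum[OF that] dt by (simp add: field_simps)
      show "bcont \<Omega> (\<lambda>x. V x + 1 / dt * (r x * (w x \<bullet> (w x - us M x))))"
        by (intro bcont_intros V_bc r_bc w_bc us_bc order_refl)
    qed
    \<comment> \<open>The dissipation need not be integrable here: its integral would then be the junk value 0.\<close>
    have visc: "I (\<lambda>x. w x \<bullet> viscous lam eta w x) \<le> 0"
    proof -
      have "0 \<le> I (\<lambda>x. lam x * divg w x * divg w x + eta x * (sym_grad w x \<bullet> vgrad w x))"
        unfolding I_def set_lebesgue_integral_def
      proof (intro integral_nonneg_AE AE_I2)
        fix x
        show "0 \<le> indicat_real \<Omega> x *\<^sub>R (lam x * divg w x * divg w x + eta x * (sym_grad w x \<bullet> vgrad w x))"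
          using coeffs_pos[of x] sym_grad_inner_vgrad_nonneg[of w x]
          by (auto simp: indicator_def mult.assoc intro: mult_nonneg_nonneg intro!: add_nonneg_nonneg)
      qed
      then show ?thesis
        using assms(44) by (simp add: ibp_viscous_def I_def w_def)
    qed
    \<comment> \<open>The new density is \<open>r\<close> plus the increments weighted by
      \<open>Mw\<close>, and \<open>momentum_flux\<close> turns the latter into
      \<open>V\<close>.\<close>
    have "kinetic \<Omega> M Mw (n (Suc k)) w
        = 1/2 * I (\<lambda>x. r x * (w x \<bullet> w x) + (\<Sum>i=1..M. Mw i * ((w x \<bullet> w x) * \<delta> i x)))"
      unfolding kinetic_def I_def[symmetric]
      by (intro arg_cong[where f = "(*) (1/2)"] I_cong)
        (simp add: rho_def r_def \<delta>_def dot_square_norm algebra_simps sum_distrib_left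
          sum_distrib_right sum_subtractf)
    also have "\<dots> = 1/2 * I (\<lambda>x. r x * (w x \<bullet> w x)) + dt * I V"
    proof -
      have I_V: "I V = (\<Sum>i=1..M. Mw i * I (C i))"
        unfolding V_def[abs_def] by (subst I_sum) (auto intro!: bcont_intros C_bc simp: I_mult)
      have "(\<Sum>i=1..M. Mw i * I (\<lambda>x. (w x \<bullet> w x) * \<delta> i x)) = 2 * (dt * I V)"
        unfolding I_V sum_distrib_left by (intro sum.cong refl) (simp add: momentum_flux)
      then show ?thesis
        by (subst I_add, (intro bcont_intros r_bc w_bc \<delta>_bc; simp)+, subst I_sum)
          (auto intro!: bcont_intros w_bc \<delta>_bc simp: I_mult I_divide)
    qed
    also have "\<dots> = I (\<lambda>x. 1/2 * (r x * (w x \<bullet> w x)) + dt * V x)"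
      by (subst I_add) (auto intro!: bcont_intros r_bc w_bc V_bc simp: I_mult I_divide)
    also have "\<dots> \<le> I (\<lambda>x. dt * (w x \<bullet> viscous lam eta w x) + 1/2 * (r x * (us M x \<bullet> us M x)))"
    proof (rule I_mono)
      fix x assume x: "x \<in> \<Omega>"
      \<comment> \<open>Inserting \<open>momentum\<close> eliminates \<open>V\<close> and leaves
        viscosity and the jump \<open>w x - us M x\<close>; half the square of this jump is
        dropped.\<close>
      have "1/2 * (w x \<bullet> w x) - w x \<bullet> (w x - us M x) \<le> 1/2 * (us M x \<bullet> us M x)"
        using inner_ge_zero[of "w x - us M x"]
        by (simp add: inner_diff_left inner_diff_right inner_commute)
      moreover have "0 < r x" using rho_pos x by (simp add: r_def)
      ultimately have "r x * (1/2 * (w x \<bullet> w x) - w x \<bullet> (w x - us M x)) \<le> r x * (1/2 * (us M x \<bullet> us M x))"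
        by (intro mult_left_mono) auto
      then show "1/2 * (r x * (w x \<bullet> w x)) + dt * V x
          \<le> dt * (w x \<bullet> viscous lam eta w x) + 1/2 * (r x * (us M x \<bullet> us M x))"
        unfolding momentum[OF x] by (simp add: algebra_simps)
    qed (intro bcont_intros r_bc w_bc us_bc V_bc visc_bc order_refl)+
    also have "\<dots> = dt * I (\<lambda>x. w x \<bullet> viscous lam eta w x) + 1/2 * I (\<lambda>x. r x * (us M x \<bullet> us M x))"
      by (subst I_add) (auto intro!: bcont_intros visc_bc r_bc us_bc simp: I_mult I_divide)
    also have "\<dots> \<le> 1/2 * I (\<lambda>x. r x * (norm (us M x))\<^sup>2)"
      using mult_nonneg_nonpos[OF less_imp_le[OF dt] visc] by (simp add: dot_square_norm)
    finally show ?thesis .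
  qed

  have "kinetic \<Omega> M Mw (n k) (u k) = 1/2 * I (\<lambda>x. r x * (norm (u k x))\<^sup>2)"
    by (simp add: kinetic_def I_def r_def)
  with free mu_work kin show ?thesis
    unfolding w_def by linarith
qed

end
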